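(* Suppose that $$\Phi(t)=e^{At},\quad t\geqslant0,$$ for some stable $A\in\mathbb{M}_d$. Then $\Phi\in L^p(\mathbb{R}_+,\mathbb{M}_d)$ for any $p>0$, and $0\in\operatorname{ess\,supp}\,\mathrm{det}^*(\Phi)$.
   Context: $d\in\mathbb{N}$; $\mathbb{R}_+=[0,\infty)$; $\mathbb{M}_d$ is the space of real $d\times d$ matrices; $A\in\mathbb{M}_d$ is stable if all its eigenvalues have strictly negative real parts; $e^{At}$ is the matrix exponential. $G\in L^p(\mathbb{R}_+,\mathbb{M}_d)$ means that each entry $G_{i,j}$ is measurable with $\int_0^\infty|G_{i,j}(u)|^p\mathrm{d}u<\infty$. Convolution: $(g*h)(t)=\int_0^tg(t-u)h(u)\mathrm{d}u$. Convolution determinant: $\mathrm{det}^*(\Phi)(t)=\sum_{\sigma\in S_d}\mathrm{sgn}(\sigma)\big(\Phi_{1,\sigma(1)}*\cdots*\Phi_{d,\sigma(d)}\big)(t)$, $t\geqslant0$, where $S_d$ is the group of permutations of $\{1,\dots,d\}$. The essential support $\operatorname{ess\,supp}f$ of a function $f$ on $\mathbb{R}_+$ (extended by $0$ to $\mathbb{R}$) is the smallest closed subset of $\mathbb{R}$ such that $f=0$ almost everywhere in its complement. *)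

theory Defs
  imports "HOL-Analysis.Analysis" "Jordan_Normal_Form.Char_Poly"
begin

text \<open>
  The \<open>d \<times> d\<close> real matrices are the elements of \<open>carrier_mat d d\<close>; rows and columns are
  indexed by \<open>0, \<dots>, d - 1\<close> instead of \<open>1, \<dots>, d\<close>. Measure and integral are
  Lebesgue's throughout.
\<close>

definition stable_mat :: "real mat \<Rightarrow> bool" where
  "stable_mat A \<longleftrightarrow>
     (\<forall>z::complex. eigenvalue (map_mat complex_of_real A) z \<longrightarrow> Re z < 0)"

text \<open>
  In finite dimension, convergence of the exponential series in norm is entrywise convergence.
  The matrix powers must be \<open>^\<^sub>m\<close>.
\<close>
definition mat_exp :: "real mat \<Rightarrow> real mat" where
  "mat_exp A = mat (dim_row A) (dim_col A) (\<lambda>(i, j). \<Sum>k. (A ^\<^sub>m k) $$ (i, j) / fact k)"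

text \<open>
  Functions on \<open>[0, \<infinity>)\<close> are represented by total functions on \<open>real\<close>; their values at
  negative arguments are irrelevant.
\<close>
definition Lp_mat :: "nat \<Rightarrow> real \<Rightarrow> (real \<Rightarrow> real mat) \<Rightarrow> bool" where
  "Lp_mat d p G \<longleftrightarrow>
     (\<forall>t\<ge>0. G t \<in> carrier_mat d d) \<and>
     (\<forall>i<d. \<forall>j<d.
        set_borel_measurable lebesgue {0..} (\<lambda>u. G u $$ (i, j)) \<and>
        (\<integral>\<^sup>+u\<in>{0..}. ennreal (\<bar>G u $$ (i, j)\<bar> powr p) \<partial>lebesgue) < \<infinity>)"

definition conv :: "(real \<Rightarrow> real) \<Rightarrow> (real \<Rightarrow> real) \<Rightarrow> real \<Rightarrow> real" where
  "conv g h t = (LINT u:{0..t}|lebesgue. g (t - u) * h u)"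

text \<open>\<open>conv_upto f n\<close> is \<open>f 0 * f 1 * \<dots> * f n\<close> (\<open>n + 1\<close> factors), bracketed to the left.\<close>
primrec conv_upto :: "(nat \<Rightarrow> real \<Rightarrow> real) \<Rightarrow> nat \<Rightarrow> real \<Rightarrow> real" where
  "conv_upto f 0 = f 0"
| "conv_upto f (Suc n) = conv (conv_upto f n) (f (Suc n))"

text \<open>
  The definition is meant for \<open>d \<ge> 1\<close>: convolution has no unit among functions, so there is
  no empty convolution product.
\<close>
definition conv_det :: "nat \<Rightarrow> (real \<Rightarrow> real mat) \<Rightarrow> real \<Rightarrow> real" where
  "conv_det d F t =
     (\<Sum>\<sigma> | \<sigma> permutes {0..<d}.
        real_of_int (sign \<sigma>) * conv_upto (\<lambda>i s. F s $$ (i, \<sigma> i)) (d - 1) t)"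

text \<open>The essential support of a function on \<open>[0, \<infinity>)\<close>, extended by 0 to the real line.\<close>
definition ess_supp :: "(real \<Rightarrow> real) \<Rightarrow> real set" where
  "ess_supp f =
     \<Inter>{S. closed S \<and> (AE x in lebesgue. x \<notin> S \<longrightarrow> (if 0 \<le> x then f x else 0) = 0)}"

text \<open>The intersection is itself one of the sets intersected, hence the smallest of them.\<close>
lemma closed_ess_supp: "closed (ess_supp f)"
  unfolding ess_supp_def by (intro closed_Inter) auto

lemma AE_ess_supp:
  "AE x in lebesgue. x \<notin> ess_supp f \<longrightarrow> (if 0 \<le> x then f x else 0) = 0"
proof -
  define P where "P x \<longleftrightarrow> (if 0 \<le> x then f x else 0) = 0" for x
  define \<F> where "\<F> = uminus ` {S. closed S \<and> (AE x in lebesgue. x \<notin> S \<longrightarrow> P x)}"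
  obtain \<G> where G: "\<G> \<subseteq> \<F>" "countable \<G>" "\<Union>\<G> = \<Union>\<F>"
    using Lindelof[of \<F>] by (auto simp: \<F>_def)
  have "AE x in lebesgue. \<forall>U\<in>\<G>. x \<in> U \<longrightarrow> P x"
    using G(1,2) by (subst AE_ball_countable) (auto simp: \<F>_def)
  then show ?thesis
  proof eventually_elim
    case (elim x)
    have "x \<in> \<Union>\<F>" if "x \<notin> ess_supp f"
      using that by (auto simp: ess_supp_def \<F>_def P_def)
    then show ?case
      using elim G(3) by (auto simp: P_def)
  qed
qed

lemma ess_supp_least:
  assumes "closed S" and "AE x in lebesgue. x \<notin> S \<longrightarrow> (if 0 \<le> x then f x else 0) = 0"
  shows "ess_supp f \<subseteq> S"
  using assms unfolding ess_supp_def by blast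

end

theory Submission
  imports Defs "Jordan_Normal_Form.Spectral_Radius" "HOL-Real_Asymp.Real_Asymp"
begin

text \<open>
  Decay: since the eigenvalues of \<open>A\<close> lie in the open left half plane, for large \<open>c\<close> the spectral
  radius of \<open>B = A + c I\<close> is less than some \<open>r < c\<close>. Hence the entries of \<open>B\<^sup>k\<close> are
  \<open>O(r\<^sup>k)\<close>, those of the exponential of \<open>t B\<close> are \<open>O(exp (r t))\<close>, and multiplying by
  \<open>exp (- c t)\<close> gives the bound \<open>O(exp (- (c - r) t))\<close> for the entries of \<open>\<Phi> t\<close>.

  Support: near \<open>0\<close> the entries of \<open>\<Phi> t\<close> are \<open>\<delta>\<^sub>i\<^sub>j + O(t)\<close>. A convolution of \<open>d\<close> functions
  \<open>a\<^sub>i + O(t)\<close> is \<open>(\<Prod>i. a\<^sub>i) t\<^bsup>d-1\<^esup>/(d-1)! + O(t\<^sup>d)\<close>, so the convolution determinant is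
  \<open>det I t\<^bsup>d-1\<^esup>/(d-1)! + O(t\<^sup>d)\<close> and does not vanish on some interval \<open>(0, \<epsilon>)\<close>.
\<close>

subsection \<open>Powers and exponentials of stable matrices\<close>

lemma pow_smult_mat:
  fixes A :: "'a :: comm_ring_1 mat"
  assumes "A \<in> carrier_mat n n"
  shows "(c \<cdot>\<^sub>m A) ^\<^sub>m k = c ^ k \<cdot>\<^sub>m (A ^\<^sub>m k)"
proof (induction k)
  case 0
  then show ?case using assms by (intro eq_matI) auto
next
  case (Suc k)
  have "(c \<cdot>\<^sub>m A) ^\<^sub>m Suc k = (c ^ k \<cdot>\<^sub>m (A ^\<^sub>m k)) * (c \<cdot>\<^sub>m A)"
    using Suc by simp
  also have "\<dots> = c ^ Suc k \<cdot>\<^sub>m (A ^\<^sub>m k * A)"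
    using assms pow_carrier_mat[OF assms, of k] by (intro eq_matI) (auto simp: ac_simps)
  finally show ?case by simp
qed

text \<open>Pascal's rule, with the index shifted in one of the two sums. The right-hand side is the
  form that one multiplication by \<open>B - c I\<close> produces in the next induction.\<close>

lemma binomial_sum_Suc:
  fixes x :: "'a :: comm_ring_1"
  shows "(\<Sum>m\<le>Suc k. of_nat (Suc k choose m) * x ^ (Suc k - m) * f m)
       = (\<Sum>m\<le>k. of_nat (k choose m) * x ^ (k - m) * f (Suc m))
         + x * (\<Sum>m\<le>k. of_nat (k choose m) * x ^ (k - m) * f m)"
proof -
  let ?g = "\<lambda>m. of_nat (k choose m) * x ^ (Suc k - m) * f m"
  have "(\<Sum>m\<le>Suc k. of_nat (Suc k choose m) * x ^ (Suc k - m) * f m)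
      = x ^ Suc k * f 0
        + (\<Sum>m\<le>k. of_nat (k choose m) * x ^ (k - m) * f (Suc m) + ?g (Suc m))"
    by (subst sum.atMost_Suc_shift) (simp add: algebra_simps)
  also have "\<dots> = (\<Sum>m\<le>k. of_nat (k choose m) * x ^ (k - m) * f (Suc m)) + (\<Sum>m\<le>Suc k. ?g m)"
    by (subst sum.atMost_Suc_shift) (simp add: sum.distrib)
  also have "(\<Sum>m\<le>Suc k. ?g m) = (\<Sum>m\<le>k. ?g m)"
    by (simp add: binomial_eq_0)
  also have "\<dots> = x * (\<Sum>m\<le>k. of_nat (k choose m) * x ^ (k - m) * f m)"
    by (auto simp: sum_distrib_left Suc_diff_le ac_simps intro!: sum.cong)
  finally show ?thesis .
qed

text \<open>The binomial theorem for \<open>A = B + (-c) I\<close>, valid because the identity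
  commutes with \<open>B\<close>. It is entrywise so that bounds on the entries of
  \<open>B ^\<^sub>m m\<close> can be inserted directly; \<open>j\<close> varies in the induction
  because multiplying by \<open>B\<close> mixes columns.\<close>

lemma pow_mat_shift:
  fixes A :: "'a :: comm_ring_1 mat"
  assumes "A \<in> carrier_mat n n" "i < n" "j < n"
  shows "(A ^\<^sub>m k) $$ (i, j) =
    (\<Sum>m\<le>k. of_nat (k choose m) * (- c) ^ (k - m) * ((A + c \<cdot>\<^sub>m 1\<^sub>m n) ^\<^sub>m m) $$ (i, j))"
  using assms(3)
proof (induction k arbitrary: j)
  case 0
  then show ?case using assms by simp
next
  case (Suc k)
  define B where "B = A + c \<cdot>\<^sub>m 1\<^sub>m n"
  have B: "B \<in> carrier_mat n n" using assms by (auto simp: B_def)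
  note Bk = pow_carrier_mat[OF B] and Ak = pow_carrier_mat[OF assms(1)]
  let ?b = "\<lambda>m. of_nat (k choose m) * (- c) ^ (k - m)"
  have "A = B + (- c) \<cdot>\<^sub>m 1\<^sub>m n"
    using assms by (auto simp: B_def intro!: eq_matI)
  then have "A ^\<^sub>m Suc k = A ^\<^sub>m k * B + (- c) \<cdot>\<^sub>m A ^\<^sub>m k"
    using Ak[of k] B mult_smult_distrib[OF Ak[of k] one_carrier_mat, of "-c"]
      mult_add_distrib_mat[OF Ak[of k] B, of "(- c) \<cdot>\<^sub>m 1\<^sub>m n"] by simp
  then have "(A ^\<^sub>m Suc k) $$ (i, j)
      = (\<Sum>l<n. (A ^\<^sub>m k) $$ (i, l) * B $$ (l, j)) - c * (A ^\<^sub>m k) $$ (i, j)"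
    using assms Suc.prems B Ak[of k]
    by (simp add: scalar_prod_def lessThan_atLeast0)
  also have "(\<Sum>l<n. (A ^\<^sub>m k) $$ (i, l) * B $$ (l, j))
      = (\<Sum>l<n. \<Sum>m\<le>k. ?b m * ((B ^\<^sub>m m) $$ (i, l) * B $$ (l, j)))"
    by (intro sum.cong) (auto simp: Suc.IH B_def[symmetric] sum_distrib_right mult.assoc)
  also have "\<dots> = (\<Sum>m\<le>k. ?b m * (\<Sum>l<n. (B ^\<^sub>m m) $$ (i, l) * B $$ (l, j)))"
    by (subst sum.swap) (simp add: sum_distrib_left)
  also have "\<dots> = (\<Sum>m\<le>k. ?b m * (B ^\<^sub>m Suc m) $$ (i, j))"
  proof (intro sum.cong refl arg_cong2[where f = "(*)"])
    fix m show "(\<Sum>l<n. (B ^\<^sub>m m) $$ (i, l) * B $$ (l, j)) = (B ^\<^sub>m Suc m) $$ (i, j)"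
      using assms(2) Suc.prems B Bk[of m] by (simp add: scalar_prod_def lessThan_atLeast0)
  qed
  finally show ?case
    using binomial_sum_Suc[of k "-c" "\<lambda>m. (B ^\<^sub>m m) $$ (i, j)"] Suc.IH[OF Suc.prems]
    by (simp add: B_def[symmetric])
qed

section \<open>Spectrum and powers of the shifted matrix\<close>

lemma eigenvalue_smult_shift:
  fixes A :: "'a :: field mat"
  assumes A: "A \<in> carrier_mat n n" and "s \<noteq> 0"
    and ev: "eigenvalue (s \<cdot>\<^sub>m (A + c \<cdot>\<^sub>m 1\<^sub>m n)) z"
  shows "eigenvalue A (z / s - c)"
proof -
  obtain v where v: "v \<in> carrier_vec n" "v \<noteq> 0\<^sub>v n"
    and eq: "(s \<cdot>\<^sub>m (A + c \<cdot>\<^sub>m 1\<^sub>m n)) *\<^sub>v v = z \<cdot>\<^sub>v v"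
    using ev A by (auto simp: eigenvalue_def eigenvector_def)
  \<comment> \<open>The eigenvector is kept: \<open>s (A v + c v) = z v\<close> is solved for
    \<open>A v\<close>.\<close>
  have "A *\<^sub>v v = (z / s - c) \<cdot>\<^sub>v v"
  proof (rule eq_vecI)
    fix i assume "i < dim_vec ((z / s - c) \<cdot>\<^sub>v v)"
    then have i: "i < n" using v by simp
    have "((s \<cdot>\<^sub>m (A + c \<cdot>\<^sub>m 1\<^sub>m n)) *\<^sub>v v) $ i = s * ((A *\<^sub>v v) $ i + c * v $ i)"
    proof -
      have "((s \<cdot>\<^sub>m (A + c \<cdot>\<^sub>m 1\<^sub>m n)) *\<^sub>v v) $ i
          = (\<Sum>l = 0..<n. s * (A $$ (i, l) + c * (if i = l then 1 else 0)) * v $ l)"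
        using i v A by (auto simp: scalar_prod_def intro!: sum.cong)
      also have "\<dots> = (\<Sum>l = 0..<n. s * (A $$ (i, l) * v $ l) + (if l = i then s * c * v $ l else 0))"
        by (intro sum.cong refl) (simp add: algebra_simps)
      also have "\<dots> = s * (\<Sum>l = 0..<n. A $$ (i, l) * v $ l) + s * c * v $ i"
        using i by (simp add: sum.distrib sum_distrib_left)
      also have "\<dots> = s * ((A *\<^sub>v v) $ i + c * v $ i)"
        using i v A by (simp add: scalar_prod_def distrib_left mult.assoc)
      finally show ?thesis .
    qed
    with eq i v have "s * ((A *\<^sub>v v) $ i + c * v $ i) = z * v $ i" by simp
    then show "(A *\<^sub>v v) $ i = ((z / s - c) \<cdot>\<^sub>v v) $ i"
      using i v \<open>s \<noteq> 0\<close> by (simp add: field_simps)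
  qed (use A v in auto)
  with v A show ?thesis by (auto simp: eigenvalue_def eigenvector_def)
qed

text \<open>For \<open>Re z < 0\<close> the disc of radius \<open>c\<close> about \<open>-c\<close> contains \<open>z\<close> once \<open>c\<close> is large,
  since \<open>|z + c|\<^sup>2 - c\<^sup>2 = |z|\<^sup>2 + 2 c Re z\<close>.\<close>
lemma finite_left_half_plane_shift:
  fixes S :: "complex set"
  assumes "finite S" and neg: "\<And>z. z \<in> S \<Longrightarrow> Re z < 0"
  obtains c r :: real where "0 < r" "r < c" "\<And>z. z \<in> S \<Longrightarrow> cmod (z + of_real c) < r"
proof -
  \<comment> \<open>Each summand is the threshold beyond which \<open>|z|^2 + 2 c Re z < 0\<close>
    for that \<open>z\<close>. All summands are nonnegative, so the sum dominates each; the 1 makes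
    this strict and \<open>c\<close> positive.\<close>
  define c where "c = 1 + (\<Sum>z\<in>S. (cmod z)\<^sup>2 / (- 2 * Re z))"
  have nn: "0 \<le> (cmod z)\<^sup>2 / (- 2 * Re z)" if "z \<in> S" for z
    using neg[OF that] by (intro divide_nonneg_pos) auto
  then have c: "c \<ge> 1" unfolding c_def by (simp add: sum_nonneg del: mult_minus_left)
  have lt: "cmod (z + of_real c) < c" if "z \<in> S" for z
  proof -
    have "(cmod z)\<^sup>2 / (- 2 * Re z) < c"
      unfolding c_def using member_le_sum[OF that, of "\<lambda>z. (cmod z)\<^sup>2 / (- 2 * Re z)"] nn assms(1)
      by fastforce
    then have "(cmod z)\<^sup>2 < c * (- 2 * Re z)"
      using neg[OF that] by (simp only: pos_divide_less_eq)
    then have "(cmod (z + of_real c))\<^sup>2 < c\<^sup>2"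
      unfolding cmod_power2 by (simp add: power2_eq_square algebra_simps)
    then show ?thesis by (rule power2_less_imp_less) (use c in simp)
  qed
  \<comment> \<open>Inserting 0 covers empty \<open>S\<close> and gives \<open>0 <= q\<close>, so
    the midpoint of \<open>q\<close> and \<open>c\<close> is a positive radius.\<close>
  define q where "q = Max (insert 0 ((\<lambda>z. cmod (z + of_real c)) ` S))"
  have "q < c"
    unfolding q_def using assms(1) lt c by (subst Max_less_iff) auto
  moreover have "0 \<le> q"
    unfolding q_def using assms(1) by (intro Max_ge) auto
  moreover have "cmod (z + of_real c) \<le> q" if "z \<in> S" for z
    unfolding q_def using assms(1) that by (intro Max_ge) auto
  then have "cmod (z + of_real c) < (q + c) / 2" if "z \<in> S" for z
    using that \<open>q < c\<close> by force
  ultimately show thesis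
    by (intro that[of "(q + c) / 2" c]) auto
qed

text \<open>Dividing \<open>B = A + c I\<close> by \<open>r\<close> brings its spectral radius below
  1, so the powers of the quotient are bounded by the Jordan normal form; undoing the scaling gives
  the factor \<open>r ^ k\<close>.\<close>

lemma stable_mat_shift_pow_bound:
  assumes A: "A \<in> carrier_mat n n" and "stable_mat A"
  obtains r c C :: real where "0 < r" "r < c" "0 \<le> C"
    "\<And>k i j. i < n \<Longrightarrow> j < n \<Longrightarrow> \<bar>((A + c \<cdot>\<^sub>m 1\<^sub>m n) ^\<^sub>m k) $$ (i, j)\<bar> \<le> C * r ^ k"
proof -
  let ?h = "map_mat complex_of_real"
  have hA: "?h A \<in> carrier_mat n n" using A by simp
  obtain c r where cr: "0 < r" "r < c" "\<And>z. z \<in> spectrum (?h A) \<Longrightarrow> cmod (z + of_real c) < r"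
    using finite_left_half_plane_shift[OF card_finite_spectrum(1)[OF hA]] \<open>stable_mat A\<close>
    by (metis mem_Collect_eq spectrum_def stable_mat_def)
  define B where "B = A + c \<cdot>\<^sub>m 1\<^sub>m n"
  define B' where "B' = complex_of_real (1 / r) \<cdot>\<^sub>m (?h A + complex_of_real c \<cdot>\<^sub>m 1\<^sub>m n)"
  have B: "B \<in> carrier_mat n n" using A by (auto simp: B_def)
  have B': "B' \<in> carrier_mat n n" using A by (auto simp: B'_def)
  have hB: "B' = ?h ((1 / r) \<cdot>\<^sub>m B)"
    using A by (auto simp: B'_def B_def intro!: eq_matI)
  obtain C where C: "norm_bound (B' ^\<^sub>m k) C" for k
  \<comment> \<open>The spectral radius is a maximum over the spectrum, which is empty in dimension
    0.\<close>
  proof (cases "n = 0")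
    case True
    then have "norm_bound (B' ^\<^sub>m k) 0" for k
      using pow_carrier_mat[OF B', of k] by (auto simp: norm_bound_def)
    then show ?thesis by (rule that)
  next
    case False
    have "spectral_radius B' \<in> norm ` spectrum B'"
      using spectral_radius_mem_max(1)[OF B'] False by simp
    then obtain z where z: "eigenvalue B' z" "spectral_radius B' = norm z"
      by (auto simp: spectrum_def)
    have "z / complex_of_real (1 / r) - of_real c \<in> spectrum (?h A)"
      using eigenvalue_smult_shift[OF hA _ z(1)[unfolded B'_def]] cr(1) by (auto simp: spectrum_def)
    from cr(3)[OF this] have "norm z < 1"
      using cr(1) by (simp add: norm_mult)
    then show ?thesis
      using spectral_radius_jnf_norm_bound_less_1_upper_triangular[OF B'] z(2) that by auto
  qed
  have "\<bar>(B ^\<^sub>m k) $$ (i, j)\<bar> \<le> max 0 C * r ^ k" if "i < n" "j < n" for i j k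
  proof -
    have "B' ^\<^sub>m k = ?h ((1 / r) ^ k \<cdot>\<^sub>m B ^\<^sub>m k)"
      unfolding hB using B by (simp add: of_real_hom.mat_hom_pow[of _ n, symmetric] pow_smult_mat[OF B])
    then have "(B' ^\<^sub>m k) $$ (i, j) = of_real ((1 / r) ^ k * (B ^\<^sub>m k) $$ (i, j))"
      using pow_carrier_mat[OF B, of k] that B by simp
    moreover have "cmod ((B' ^\<^sub>m k) $$ (i, j)) \<le> C"
      using C[of k] that B' by (auto simp: norm_bound_def)
    ultimately have "(1 / r) ^ k * \<bar>(B ^\<^sub>m k) $$ (i, j)\<bar> \<le> max 0 C"
      using cr(1) by (simp only: norm_of_real abs_mult power_abs) simp
    then show ?thesis using cr(1) by (simp add: field_simps power_one_over)
  qed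
  then show thesis
    using cr(1,2) by (intro that[of r c "max 0 C"]) (auto simp: B_def)
qed

section \<open>Exponential series of the entries\<close>

lemma summable_exp_bounded:
  fixes a :: "nat \<Rightarrow> real"
  assumes "\<And>k. \<bar>a k\<bar> \<le> C * r ^ k"
  shows "summable (\<lambda>k. \<bar>a k / fact k * t ^ k\<bar>)"
    and "\<bar>\<Sum>k. a k / fact k * t ^ k\<bar> \<le> C * exp (r * \<bar>t\<bar>)"
proof -
  have s: "(\<lambda>k. C * ((r * \<bar>t\<bar>) ^ k /\<^sub>R fact k)) sums (C * exp (r * \<bar>t\<bar>))"
    by (intro sums_mult exp_converges)
  have le: "\<bar>a k / fact k * t ^ k\<bar> \<le> C * ((r * \<bar>t\<bar>) ^ k /\<^sub>R fact k)" for k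
    using mult_right_mono[OF assms[of k], of "\<bar>t\<bar> ^ k / fact k"]
    by (simp add: abs_mult power_abs power_mult_distrib field_simps)
  show 1: "summable (\<lambda>k. \<bar>a k / fact k * t ^ k\<bar>)"
    by (rule summable_comparison_test'[OF sums_summable[OF s], of 0]) (use le in auto)
  have "\<bar>\<Sum>k. a k / fact k * t ^ k\<bar> \<le> (\<Sum>k. \<bar>a k / fact k * t ^ k\<bar>)"
    by (rule summable_rabs[OF 1])
  also have "\<dots> \<le> C * exp (r * \<bar>t\<bar>)"
    using suminf_le[OF le 1 sums_summable[OF s]] sums_unique[OF s] by simp
  finally show "\<bar>\<Sum>k. a k / fact k * t ^ k\<bar> \<le> C * exp (r * \<bar>t\<bar>)" .
qed

text \<open>On \<open>[0,1]\<close> every power \<open>t ^ Suc k\<close> is at most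
  \<open>t\<close>, so \<open>K\<close> can be the sum of the absolute values of the coefficients
  after the first.\<close>

lemma exp_series_near_0:
  fixes a :: "nat \<Rightarrow> real"
  assumes "\<And>k. \<bar>a k\<bar> \<le> C * r ^ k"
  shows "\<exists>K. \<forall>t\<in>{0..1}. \<bar>(\<Sum>k. a k / fact k * t ^ k) - a 0\<bar> \<le> K * t"
proof (intro exI ballI)
  fix t :: real assume t: "t \<in> {0..1}"
  note sm = summable_exp_bounded(1)[of a C r, OF assms]
  have s1: "summable (\<lambda>k. \<bar>a (Suc k) / fact (Suc k)\<bar>)"
    using sm[of 1] by (subst (asm) summable_Suc_iff[symmetric]) simp
  have s2: "summable (\<lambda>k. \<bar>a (Suc k) / fact (Suc k) * t ^ Suc k\<bar>)"
    using sm[of t] by (subst (asm) summable_Suc_iff[symmetric])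
  have "(\<Sum>k. a k / fact k * t ^ k) - a 0 = (\<Sum>k. a (Suc k) / fact (Suc k) * t ^ Suc k)"
    using suminf_split_head[OF summable_rabs_cancel[OF sm[of t]]] by simp
  also have "\<bar>\<dots>\<bar> \<le> (\<Sum>k. \<bar>a (Suc k) / fact (Suc k) * t ^ Suc k\<bar>)"
    by (rule summable_rabs[OF s2])
  also have "\<dots> \<le> (\<Sum>k. \<bar>a (Suc k) / fact (Suc k)\<bar> * t)"
  proof (rule suminf_le[OF _ s2])
    fix k
    have "t ^ Suc k \<le> t" using t by (simp add: mult_left_le power_le_one)
    then show "\<bar>a (Suc k) / fact (Suc k) * t ^ Suc k\<bar> \<le> \<bar>a (Suc k) / fact (Suc k)\<bar> * t"
      using t mult_left_mono[of "t ^ Suc k" t "\<bar>a (Suc k) / fact (Suc k)\<bar>"]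
      by (simp only: abs_mult) auto
  qed (use s1 in \<open>rule summable_mult2\<close>)
  also have "\<dots> = (\<Sum>k. \<bar>a (Suc k) / fact (Suc k)\<bar>) * t"
    by (rule suminf_mult2[OF s1, symmetric])
  finally show "\<bar>(\<Sum>k. a k / fact k * t ^ k) - a 0\<bar> \<le> (\<Sum>k. \<bar>a (Suc k) / fact (Suc k)\<bar>) * t" .
qed

lemma mat_exp_index:
  assumes "A \<in> carrier_mat n n" "i < n" "j < n"
  shows "mat_exp (t \<cdot>\<^sub>m A) $$ (i, j) = (\<Sum>k. (A ^\<^sub>m k) $$ (i, j) / fact k * t ^ k)"
proof -
  have "((t \<cdot>\<^sub>m A) ^\<^sub>m k) $$ (i, j) = t ^ k * (A ^\<^sub>m k) $$ (i, j)" for k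
    using assms pow_carrier_mat[OF assms(1), of k] by (simp add: pow_smult_mat[OF assms(1)])
  then show ?thesis
    using assms by (simp add: mat_exp_def mult.commute)
qed

text \<open>Triangle inequality in the binomial expansion. The rate \<open>r + c\<close> is too
  crude for decay, but it gives convergence everywhere and control near 0.\<close>

lemma pow_mat_entry_bound:
  fixes A :: "real mat"
  assumes A: "A \<in> carrier_mat n n" and "i < n" "j < n" and "0 \<le> c"
    and B: "\<And>k. \<bar>((A + c \<cdot>\<^sub>m 1\<^sub>m n) ^\<^sub>m k) $$ (i, j)\<bar> \<le> C * r ^ k"
  shows "\<bar>(A ^\<^sub>m k) $$ (i, j)\<bar> \<le> C * (r + c) ^ k"
proof -
  have "\<bar>(A ^\<^sub>m k) $$ (i, j)\<bar> \<le> (\<Sum>m\<le>k. real (k choose m) * c ^ (k - m) * (C * r ^ m))"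
    unfolding pow_mat_shift[OF assms(1-3), of k c]
    using B \<open>0 \<le> c\<close> by (intro order.trans[OF sum_abs] sum_mono)
      (simp add: abs_mult power_abs mult_left_mono)
  also have "\<dots> = C * (r + c) ^ k"
    by (simp add: binomial_ring sum_distrib_left mult_ac)
  finally show ?thesis .
qed

text \<open>This is \<open>exp (t A) = exp (t B) exp (- c t)\<close> for \<open>B = A + c I\<close>,
  the source of the decay. The binomial expansion of the powers of \<open>A\<close> turns the series
  into a Cauchy product of two absolutely convergent series.\<close>

lemma mat_exp_shift:
  assumes A: "A \<in> carrier_mat n n" and ij: "i < n" "j < n"
    and B: "\<And>k. \<bar>((A + c \<cdot>\<^sub>m 1\<^sub>m n) ^\<^sub>m k) $$ (i, j)\<bar> \<le> C * r ^ k"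
  shows "mat_exp (t \<cdot>\<^sub>m A) $$ (i, j) =
    (\<Sum>k. ((A + c \<cdot>\<^sub>m 1\<^sub>m n) ^\<^sub>m k) $$ (i, j) / fact k * t ^ k) * exp (- c * t)"
proof -
  define b where "b k = ((A + c \<cdot>\<^sub>m 1\<^sub>m n) ^\<^sub>m k) $$ (i, j)" for k
  have "(A ^\<^sub>m k) $$ (i, j) / fact k * t ^ k
      = (\<Sum>m\<le>k. (b m / fact m * t ^ m) * ((- c) ^ (k - m) / fact (k - m) * t ^ (k - m)))" for k
  proof -
    have "(A ^\<^sub>m k) $$ (i, j) / fact k * t ^ k
        = (\<Sum>m\<le>k. real (k choose m) * (- c) ^ (k - m) * b m / fact k * t ^ k)"
      by (simp add: pow_mat_shift[OF A ij, of k c] b_def sum_divide_distrib sum_distrib_right)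
    also have "\<dots> = (\<Sum>m\<le>k. (b m / fact m * t ^ m) * ((- c) ^ (k - m) / fact (k - m) * t ^ (k - m)))"
    proof (intro sum.cong refl)
      fix m assume "m \<in> {..k}"
      then have "m \<le> k" by simp
      then show "real (k choose m) * (- c) ^ (k - m) * b m / fact k * t ^ k
        = (b m / fact m * t ^ m) * ((- c) ^ (k - m) / fact (k - m) * t ^ (k - m))"
        using power_add[of t m "k - m"] by (simp add: binomial_fact)
    qed
    finally show ?thesis .
  qed
  moreover have "(\<lambda>k. (- c) ^ k / fact k * t ^ k) sums exp (- c * t)"
    using exp_converges[of "- c * t"] by (simp only: power_mult_distrib) (simp add: field_simps)
  moreover have "summable (\<lambda>k. norm (b k / fact k * t ^ k))"
    using summable_exp_bounded(1)[of b C r t] B by (simp add: b_def)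
  moreover have "summable (\<lambda>k. norm ((- c) ^ k / fact k * t ^ k))"
    using summable_exp_bounded(1)[of "\<lambda>k. (- c) ^ k" 1 "\<bar>c\<bar>" t] by (simp add: power_abs)
  ultimately have "(\<lambda>k. (A ^\<^sub>m k) $$ (i, j) / fact k * t ^ k) sums
      ((\<Sum>k. b k / fact k * t ^ k) * exp (- c * t))"
    using Cauchy_product_sums[of "\<lambda>k. b k / fact k * t ^ k" "\<lambda>k. (- c) ^ k / fact k * t ^ k"]
    by (simp add: sums_iff)
  then show ?thesis
    by (simp add: mat_exp_index[OF A ij] sums_iff b_def)
qed

subsection \<open>Convolutions near the origin\<close>

text \<open>With the normalisation by \<open>n!\<close>, convolution multiplies the coefficients \<open>a\<close>, because
  \<open>t\<^sup>m/m! * t\<^sup>n/n! = t\<^bsup>m+n+1\<^esup>/(m+n+1)!\<close> as a convolution.\<close>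
definition leading_term :: "(real \<Rightarrow> real) \<Rightarrow> real \<Rightarrow> nat \<Rightarrow> bool" where
  "leading_term f a n \<longleftrightarrow> f \<in> borel_measurable borel \<and>
     (\<exists>K. \<forall>t\<in>{0..1}. \<bar>f t - a * t ^ n / fact n\<bar> \<le> K * t ^ Suc n)"

lemma leading_termE:
  assumes "leading_term f a n"
  obtains K where "0 \<le> K" "\<And>t. t \<in> {0..1} \<Longrightarrow> \<bar>f t - a * t ^ n / fact n\<bar> \<le> K * t ^ Suc n"
proof -
  obtain K where K: "\<And>t. t \<in> {0..1} \<Longrightarrow> \<bar>f t - a * t ^ n / fact n\<bar> \<le> K * t ^ Suc n"
    using assms unfolding leading_term_def by blast
  moreover have "0 \<le> K" using K[of 1] by simp
  ultimately show thesis using that by blast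
qed

lemma conv_cong:
  assumes "0 \<le> t" "\<And>s. 0 \<le> s \<Longrightarrow> g s = g' s" "\<And>s. 0 \<le> s \<Longrightarrow> h s = h' s"
  shows "conv g h t = conv g' h' t"
  unfolding conv_def by (intro set_lebesgue_integral_cong) (use assms in auto)

text \<open>Lets \<open>\<Phi>\<close>, prescribed only for nonnegative times, be exchanged for the
  exponential on the whole line.\<close>

lemma conv_upto_cong:
  assumes "\<And>i s. i \<le> n \<Longrightarrow> 0 \<le> s \<Longrightarrow> f i s = f' i s" "0 \<le> t"
  shows "conv_upto f n t = conv_upto f' n t"
  using assms by (induction n arbitrary: t) (auto intro!: conv_cong)

lemma conv_lborel:
  assumes "g \<in> borel_measurable borel" "h \<in> borel_measurable borel"
  shows "conv g h t = (LINT u:{0..t}|lborel. g (t - u) * h u)"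
  unfolding conv_def set_lebesgue_integral_def
  by (rule integral_completion) (use assms in measurable)

lemma borel_measurable_conv:
  assumes [measurable]: "g \<in> borel_measurable borel" "h \<in> borel_measurable borel"
  shows "conv g h \<in> borel_measurable borel"
proof -
  \<comment> \<open>The moving bound goes into the integrand, which is then jointly measurable in
    \<open>t\<close> and \<open>u\<close>.\<close>
  have "conv g h = (\<lambda>t. LINT u|lborel. (if 0 \<le> u \<and> u \<le> t then g (t - u) * h u else 0))"
    by (rule ext) (auto simp: conv_lborel[OF assms] set_lebesgue_integral_def indicator_def
      intro!: Bochner_Integration.integral_cong)
  then show ?thesis by simp
qed

lemma set_integral_reflect_power:
  fixes t :: real
  assumes "0 \<le> t"
  shows "set_integrable lborel {0..t} (\<lambda>u. a * (t - u) ^ n / fact n)"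
    and "(LINT u:{0..t}|lborel. a * (t - u) ^ n / fact n) = a * t ^ Suc n / fact (Suc n)"
proof -
  show "set_integrable lborel {0..t} (\<lambda>u. a * (t - u) ^ n / fact n)"
    by (intro borel_integrable_atLeastAtMost' continuous_intros) auto
  let ?F = "\<lambda>u. - a / fact (Suc n) * (t - u) ^ Suc n"
  have "(?F has_real_derivative a * (t - u) ^ n / fact n) (at u within {0..t})" for u
  proof -
    have "((\<lambda>u. t - u) has_real_derivative - 1) (at u within {0..t})"
      by (auto intro!: derivative_eq_intros)
    from DERIV_cmult[OF DERIV_power_Suc[OF this, of n], of "- a / fact (Suc n)"]
    show ?thesis by (rule DERIV_cong) (simp add: divide_simps)
  qed
  then have "(LINT u:{0..t}|lborel. a * (t - u) ^ n / fact n) = ?F t - ?F 0"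
    unfolding set_lebesgue_integral_def using assms
    by (intro integral_FTC_Icc)
      (auto intro!: continuous_intros simp: has_real_derivative_iff_has_vector_derivative)
  then show "(LINT u:{0..t}|lborel. a * (t - u) ^ n / fact n) = a * t ^ Suc n / fact (Suc n)"
    by simp
qed

text \<open>The leading parts convolve exactly. The remaining integrand is
  \<open>O(t ^ Suc n)\<close> uniformly on \<open>[0,t]\<close>, and the length of the interval
  supplies one more factor \<open>t\<close>.\<close>

lemma leading_term_conv:
  assumes g: "leading_term g a n" and h: "leading_term h b 0"
  shows "leading_term (conv g h) (a * b) (Suc n)"
proof -
  have meas: "g \<in> borel_measurable borel" "h \<in> borel_measurable borel"
    using g h by (auto simp: leading_term_def)
  note [measurable] = meas
  obtain K where K0: "0 \<le> K"
    and K: "\<And>t. t \<in> {0..1} \<Longrightarrow> \<bar>g t - a * t ^ n / fact n\<bar> \<le> K * t ^ Suc n"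
    using leading_termE[OF g] by blast
  obtain L where L0: "0 \<le> L" and L: "\<And>t. t \<in> {0..1} \<Longrightarrow> \<bar>h t - b\<bar> \<le> L * t"
    using leading_termE[OF h] by auto
  \<comment> \<open>The error of \<open>g\<close> meets \<open>|h| <= |b| + L\<close>; the error of
    \<open>h\<close> meets the leading part of \<open>g\<close>, at most
    \<open>|a| t ^ n\<close>.\<close>
  define M where "M = K * (\<bar>b\<bar> + L) + \<bar>a\<bar> * L"
  have "\<bar>conv g h t - a * b * t ^ Suc n / fact (Suc n)\<bar> \<le> M * t ^ Suc (Suc n)"
    if t: "t \<in> {0..1}" for t
  proof -
    let ?p = "\<lambda>u. a * b * (t - u) ^ n / fact n"
    let ?e = "\<lambda>u. g (t - u) * h u - ?p u"
    have bound: "\<bar>?e u\<bar> \<le> M * t ^ Suc n" if u: "u \<in> {0..t}" for u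
    proof -
      have tu: "(t - u) ^ k \<le> t ^ k" for k using u by (intro power_mono) auto
      have 1: "\<bar>g (t - u) - a * (t - u) ^ n / fact n\<bar> \<le> K * t ^ Suc n"
        using K[of "t - u"] mult_left_mono[OF tu[of "Suc n"] K0] u t by auto
      have 2: "\<bar>h u - b\<bar> \<le> L * t"
        using L[of u] mult_left_mono[of u t L] L0 u t by auto
      have "L * t \<le> L" using t L0 by (simp add: mult_left_le)
      with 2 have 3: "\<bar>h u\<bar> \<le> \<bar>b\<bar> + L" by linarith
      have 4: "\<bar>a * (t - u) ^ n / fact n\<bar> \<le> \<bar>a\<bar> * t ^ n"
      proof -
        have "(t - u) ^ n / fact n \<le> t ^ n"
          using tu[of n] u t fact_ge_1[of n, where 'a = real]
          by (smt (verit) atLeastAtMost_iff divide_right_mono divide_self_if frac_le zero_le_power div_by_1)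
        then show ?thesis
          using u mult_left_mono[of "(t - u) ^ n / fact n" "t ^ n" "\<bar>a\<bar>"] by (simp add: abs_mult)
      qed
      have "?e u = (g (t - u) - a * (t - u) ^ n / fact n) * h u + (a * (t - u) ^ n / fact n) * (h u - b)"
        by (simp add: left_diff_distrib right_diff_distrib)
      also have "\<bar>\<dots>\<bar> \<le> (K * t ^ Suc n) * (\<bar>b\<bar> + L) + (\<bar>a\<bar> * t ^ n) * (L * t)"
      proof (rule order.trans[OF abs_triangle_ineq add_mono])
        show "\<bar>(g (t - u) - a * (t - u) ^ n / fact n) * h u\<bar> \<le> (K * t ^ Suc n) * (\<bar>b\<bar> + L)"
          unfolding abs_mult by (rule mult_mono[OF 1 3]) (use K0 t in auto)
        show "\<bar>(a * (t - u) ^ n / fact n) * (h u - b)\<bar> \<le> (\<bar>a\<bar> * t ^ n) * (L * t)"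
          unfolding abs_mult[of _ "h u - b"] by (rule mult_mono[OF 4 2]) (use t in auto)
      qed
      also have "\<dots> = M * t ^ Suc n"
        by (simp add: M_def algebra_simps)
      finally show ?thesis .
    qed
    have pint: "set_integrable lborel {0..t} ?p"
      and pval: "(LINT u:{0..t}|lborel. ?p u) = a * b * t ^ Suc n / fact (Suc n)"
      using set_integral_reflect_power[of t "a * b" n] t by auto
    have cint: "set_integrable lborel {0..t} (\<lambda>u. M * t ^ Suc n)"
      by (intro borel_integrable_atLeastAtMost' continuous_intros)
    \<comment> \<open>Integrability comes from boundedness on an interval of finite measure, as
      \<open>g\<close> and \<open>h\<close> are only known to be Borel measurable.\<close>
    have eint: "set_integrable lborel {0..t} ?e"
      unfolding set_integrable_def
      by (rule integrableI_bounded_set_indicator[where B = "M * t ^ Suc n"])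
        (use bound t in \<open>auto simp: emeasure_lborel_Icc_eq\<close>)
    have "conv g h t = (LINT u:{0..t}|lborel. ?p u + ?e u)"
      by (simp add: conv_lborel[OF meas])
    also have "\<dots> = a * b * t ^ Suc n / fact (Suc n) + (LINT u:{0..t}|lborel. ?e u)"
      by (simp only: set_integral_add(2)[OF pint eint] pval)
    finally have "\<bar>conv g h t - a * b * t ^ Suc n / fact (Suc n)\<bar> = \<bar>LINT u:{0..t}|lborel. ?e u\<bar>"
      by simp
    also have "\<dots> \<le> (LINT u:{0..t}|lborel. \<bar>?e u\<bar>)"
      using set_integral_norm_bound[OF eint] by simp
    also have "\<dots> \<le> (LINT u:{0..t}|lborel. M * t ^ Suc n)"
      by (rule set_integral_mono[OF set_integrable_abs[OF eint] cint bound])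
    also have "\<dots> = M * t ^ Suc (Suc n)"
      using t by (simp add: set_lebesgue_integral_def)
    finally show ?thesis .
  qed
  then show ?thesis
    using borel_measurable_conv[OF meas] unfolding leading_term_def by blast
qed

text \<open>Each convolution raises the order by one. Bracketing to the left keeps the new right
  factor at order 0, as \<open>leading_term_conv\<close> requires.\<close>

lemma leading_term_conv_upto:
  assumes "\<And>i. i \<le> n \<Longrightarrow> leading_term (f i) (a i) 0"
  shows "leading_term (conv_upto f n) (\<Prod>i\<le>n. a i) n"
  using assms by (induction n) (auto intro: leading_term_conv)

text \<open>The coefficients may vanish or cancel: \<open>leading_term\<close> with coefficient 0
  just says \<open>O(t ^ Suc n)\<close>. This admits the off-diagonal entries in the Leibniz
  sum.\<close>

lemma leading_term_sum:
  assumes "finite I" "\<And>i. i \<in> I \<Longrightarrow> leading_term (f i) (a i) n"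
  shows "leading_term (\<lambda>t. \<Sum>i\<in>I. c i * f i t) (\<Sum>i\<in>I. c i * a i) n"
proof -
  have "\<forall>i\<in>I. \<exists>K. \<forall>t\<in>{0..1}. \<bar>f i t - a i * t ^ n / fact n\<bar> \<le> K * t ^ Suc n"
    using assms by (auto simp: leading_term_def)
  then obtain K where K: "\<And>i t. i \<in> I \<Longrightarrow> t \<in> {0..1} \<Longrightarrow>
      \<bar>f i t - a i * t ^ n / fact n\<bar> \<le> K i * t ^ Suc n"
    by metis
  have "\<bar>(\<Sum>i\<in>I. c i * f i t) - (\<Sum>i\<in>I. c i * a i) * t ^ n / fact n\<bar>
      \<le> (\<Sum>i\<in>I. \<bar>c i\<bar> * K i) * t ^ Suc n" if t: "t \<in> {0..1}" for t
  proof -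
    have "(\<Sum>i\<in>I. c i * f i t) - (\<Sum>i\<in>I. c i * a i) * t ^ n / fact n
        = (\<Sum>i\<in>I. c i * (f i t - a i * t ^ n / fact n))"
      by (simp add: sum_distrib_right sum_divide_distrib sum_subtractf right_diff_distrib mult.assoc)
    also have "\<bar>\<dots>\<bar> \<le> (\<Sum>i\<in>I. \<bar>c i\<bar> * (K i * t ^ Suc n))"
      by (intro order.trans[OF sum_abs] sum_mono) (auto simp only: abs_mult intro!: mult_left_mono K t)
    finally show ?thesis by (simp add: sum_distrib_right mult.assoc)
  qed
  moreover have "(\<lambda>t. \<Sum>i\<in>I. c i * f i t) \<in> borel_measurable borel"
    using assms(2) by (intro borel_measurable_sum borel_measurable_times) (auto simp: leading_term_def)
  ultimately show ?thesis unfolding leading_term_def by blast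
qed

text \<open>Just right of 0 the leading term exceeds the error, so \<open>f\<close> has no zero
  there. A closed \<open>S\<close> missing 0 would make such an interval a null set.\<close>

lemma leading_term_ess_supp:
  assumes "leading_term f a n" "a \<noteq> 0"
  shows "0 \<in> ess_supp f"
proof (unfold ess_supp_def, intro InterI, elim CollectE conjE, rule ccontr)
  fix S :: "real set"
  assume "closed S" "0 \<notin> S" and AE: "AE x in lebesgue. x \<notin> S \<longrightarrow> (if 0 \<le> x then f x else 0) = 0"
  obtain K where "0 \<le> K"
    and K: "\<And>t. t \<in> {0..1} \<Longrightarrow> \<bar>f t - a * t ^ n / fact n\<bar> \<le> K * t ^ Suc n"
    using leading_termE[OF assms(1)] by blast
  obtain e where e: "e > 0" "ball 0 e \<subseteq> - S"
    using \<open>closed S\<close> \<open>0 \<notin> S\<close> by (metis ComplI open_Compl open_contains_ball)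
  \<comment> \<open>\<open>e\<close> keeps the interval off \<open>S\<close>, 1 keeps it in the
    range of the estimate, and the quotient forces \<open>K * t < |a| / fact n\<close>;
    \<open>K + 1\<close> avoids division by 0.\<close>
  define \<delta> where "\<delta> = min (min e 1) (\<bar>a\<bar> / fact n / (K + 1))"
  have "\<delta> > 0" using e assms(2) \<open>K \<ge> 0\<close> by (auto simp: \<delta>_def)
  have nz: "f t \<noteq> 0" "t \<notin> S" if t: "t \<in> {0<..<\<delta>}" for t
  proof -
    show "t \<notin> S" using e t by (auto simp: \<delta>_def subset_iff dist_real_def)
    have "t * (K + 1) < \<bar>a\<bar> / fact n"
      using t \<open>K \<ge> 0\<close> by (simp add: \<delta>_def less_divide_eq mult_ac)
    then have "K * t < \<bar>a\<bar> / fact n" using t by (simp add: algebra_simps)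
    then have "K * t ^ Suc n < \<bar>a * t ^ n / fact n\<bar>"
      using t mult_strict_right_mono[of "K * t" "\<bar>a\<bar> / fact n" "t ^ n"] by (simp add: abs_mult mult_ac)
    with K[of t] t show "f t \<noteq> 0" by (auto simp: \<delta>_def)
  qed
  have "AE x in lebesgue. x \<notin> {0<..<\<delta>}"
    using AE by eventually_elim (use nz in fastforce)
  then have "emeasure lebesgue {0<..<\<delta>} = 0"
    by (subst (asm) AE_iff_measurable[of "{0<..<\<delta>}"]) auto
  then show False using \<open>\<delta> > 0\<close> by simp
qed

subsection \<open>The matrix exponential of a stable matrix\<close>

text \<open>The crude bound on the powers of \<open>A\<close> gives an everywhere convergent power
  series, hence continuity and the behaviour at 0; the shifted form gives decay at rate
  \<open>c - r\<close>.\<close>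

lemma stable_mat_exp_entry:
  assumes A: "A \<in> carrier_mat n n" and "stable_mat A" and ij: "i < n" "j < n"
  shows "continuous_on UNIV (\<lambda>t. mat_exp (t \<cdot>\<^sub>m A) $$ (i, j))"
    and "\<exists>C \<epsilon>. 0 < \<epsilon> \<and> (\<forall>t\<ge>0. \<bar>mat_exp (t \<cdot>\<^sub>m A) $$ (i, j)\<bar> \<le> C * exp (- \<epsilon> * t))"
    and "leading_term (\<lambda>t. mat_exp (t \<cdot>\<^sub>m A) $$ (i, j)) (1\<^sub>m n $$ (i, j)) 0"
proof -
  obtain r c C :: real where cr: "0 < r" "r < c" "0 \<le> C"
    and bound: "\<And>k i j. i < n \<Longrightarrow> j < n \<Longrightarrow> \<bar>((A + c \<cdot>\<^sub>m 1\<^sub>m n) ^\<^sub>m k) $$ (i, j)\<bar> \<le> C * r ^ k"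
    by (fact stable_mat_shift_pow_bound[OF A \<open>stable_mat A\<close>])
  note B = bound[OF ij]
  define a where "a k = (A ^\<^sub>m k) $$ (i, j)" for k
  have a: "\<bar>a k\<bar> \<le> C * (r + c) ^ k" for k
    unfolding a_def using cr by (intro pow_mat_entry_bound[OF A ij _ B]) simp
  have eq: "(\<lambda>t. mat_exp (t \<cdot>\<^sub>m A) $$ (i, j)) = (\<lambda>t. \<Sum>k. a k / fact k * t ^ k)"
    by (rule ext) (simp add: mat_exp_index[OF A ij] a_def)
  have "summable (\<lambda>k. a k / fact k * t ^ k)" for t
    by (rule summable_rabs_cancel[OF summable_exp_bounded(1)[OF a]])
  then show cont: "continuous_on UNIV (\<lambda>t. mat_exp (t \<cdot>\<^sub>m A) $$ (i, j))"
    unfolding eq by (intro continuous_at_imp_continuous_on ballI isCont_powser_converges_everywhere)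
  have "a 0 = 1\<^sub>m n $$ (i, j)" using A by (simp add: a_def)
  with exp_series_near_0[OF a]
  show "leading_term (\<lambda>t. mat_exp (t \<cdot>\<^sub>m A) $$ (i, j)) (1\<^sub>m n $$ (i, j)) 0"
    using borel_measurable_continuous_onI[OF cont] unfolding leading_term_def eq by simp
  have "\<bar>mat_exp (t \<cdot>\<^sub>m A) $$ (i, j)\<bar> \<le> C * exp (- (c - r) * t)" if "t \<ge> 0" for t
  proof -
    have "\<bar>mat_exp (t \<cdot>\<^sub>m A) $$ (i, j)\<bar> \<le> (C * exp (r * \<bar>t\<bar>)) * exp (- c * t)"
      unfolding mat_exp_shift[OF A ij B] abs_mult
      using mult_right_mono[OF summable_exp_bounded(2)[OF B, of t], of "exp (- c * t)"] by simp
    also have "\<dots> = C * exp (- (c - r) * t)"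
      using that by (simp add: exp_add[symmetric] algebra_simps)
    finally show ?thesis .
  qed
  then show "\<exists>C \<epsilon>. 0 < \<epsilon> \<and> (\<forall>t\<ge>0. \<bar>mat_exp (t \<cdot>\<^sub>m A) $$ (i, j)\<bar> \<le> C * exp (- \<epsilon> * t))"
    using cr by (intro exI[of _ C] exI[of _ "c - r"]) simp
qed

lemma nn_integral_powr_exp_decay:
  fixes f :: "real \<Rightarrow> real"
  assumes "0 < p" "0 < \<epsilon>" and f: "\<And>t. 0 \<le> t \<Longrightarrow> \<bar>f t\<bar> \<le> C * exp (- \<epsilon> * t)"
  shows "(\<integral>\<^sup>+u\<in>{0..}. ennreal (\<bar>f u\<bar> powr p) \<partial>lebesgue) < \<infinity>"
proof -
  let ?g = "\<lambda>u. C powr p * exp (- (p * \<epsilon>) * u)"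
  let ?G = "\<lambda>u. - (C powr p / (p * \<epsilon>)) * exp (- (p * \<epsilon>) * u)"
  \<comment> \<open>Needed to split the real power of the product
    \<open>C * exp (- \<epsilon> * u)\<close>.\<close>
  have "0 \<le> C" using f[of 0] by simp
  have "(\<integral>\<^sup>+u\<in>{0..}. ennreal (\<bar>f u\<bar> powr p) \<partial>lebesgue) \<le> (\<integral>\<^sup>+u\<in>{0..}. ennreal (?g u) \<partial>lebesgue)"
  proof (rule nn_integral_mono)
    fix u :: real
    have "\<bar>f u\<bar> powr p \<le> ?g u" if "0 \<le> u"
    proof -
      have "\<bar>f u\<bar> powr p \<le> (C * exp (- \<epsilon> * u)) powr p"
        using f[OF that] \<open>0 < p\<close> by (intro powr_mono2) auto
      also have "\<dots> = ?g u"
        using \<open>0 \<le> C\<close> by (simp add: powr_mult exp_powr_real mult_ac)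
      finally show ?thesis .
    qed
    then show "ennreal (\<bar>f u\<bar> powr p) * indicator {0..} u \<le> ennreal (?g u) * indicator {0..} u"
      by (auto simp: indicator_def intro!: ennreal_leI)
  qed
  also have "\<dots> = (\<integral>\<^sup>+u\<in>{0..}. ennreal (?g u) \<partial>lborel)"
    by (rule nn_integral_completion)
  also have "\<dots> = ennreal (0 - ?G 0)"
  proof (rule nn_integral_FTC_atLeast)
    show "(?G \<longlongrightarrow> 0) at_top"
      using assms(1,2) by real_asymp
    show "DERIV ?G u :> ?g u" for u
      using assms(1,2) by (auto intro!: derivative_eq_intros)
  qed auto
  finally show ?thesis by (auto intro: le_less_trans)
qed

text \<open>Each permutation contributes its ordinary product of entries of \<open>M\<close> as
  coefficient, so the signed sum is the Leibniz formula for \<open>det M\<close>.\<close>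

lemma leading_term_conv_det:
  assumes "d \<ge> 1" and "M \<in> carrier_mat d d"
    and "\<And>i j. i < d \<Longrightarrow> j < d \<Longrightarrow> leading_term (\<lambda>t. F t $$ (i, j)) (M $$ (i, j)) 0"
  shows "leading_term (conv_det d F) (det M) (d - 1)"
proof -
  have "leading_term (conv_upto (\<lambda>i s. F s $$ (i, \<sigma> i)) (d - 1)) (\<Prod>i\<le>d - 1. M $$ (i, \<sigma> i)) (d - 1)"
    if "\<sigma> permutes {0..<d}" for \<sigma>
    using assms(1,3) permutes_in_image[OF that]
    by (intro leading_term_conv_upto) (auto simp: less_eq_Suc_le)
  then have "leading_term (conv_det d F)
      (\<Sum>\<sigma> | \<sigma> permutes {0..<d}. real_of_int (sign \<sigma>) * (\<Prod>i\<le>d - 1. M $$ (i, \<sigma> i))) (d - 1)"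
    unfolding conv_det_def[abs_def] by (intro leading_term_sum) (auto simp: finite_permutations)
  \<comment> \<open>Here \<open>d >= 1\<close> matters, since subtraction on naturals
    truncates.\<close>
  moreover have "{..d - 1} = {0..<d}" using assms(1) by auto
  ultimately show ?thesis by (simp add: det_def'[OF assms(2)])
qed

theorem proposition3p9:
  fixes d :: nat and A :: "real mat" and \<Phi> :: "real \<Rightarrow> real mat"
  assumes "d \<ge> 1"
    and "A \<in> carrier_mat d d"
    and "stable_mat A"
    and "\<And>t. t \<ge> 0 \<Longrightarrow> \<Phi> t = mat_exp (t \<cdot>\<^sub>m A)"
  shows "(\<forall>p::real. p > 0 \<longrightarrow> Lp_mat d p \<Phi>) \<and> 0 \<in> ess_supp (conv_det d \<Phi>)"
proof (intro conjI allI impI)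
  fix p :: real assume "p > 0"
  show "Lp_mat d p \<Phi>"
    unfolding Lp_mat_def
  proof (intro conjI allI impI)
    show "\<Phi> t \<in> carrier_mat d d" if "t \<ge> 0" for t
      using assms(2,4) that by (simp add: mat_exp_def)
    fix i j assume ij: "i < d" "j < d"
    note entry = stable_mat_exp_entry[OF assms(2,3) ij]
    \<comment> \<open>The indicator hides the unspecified values of \<open>\<Phi>\<close> at
      negative times.\<close>
    have "(\<lambda>u. indicat_real {0..} u *\<^sub>R \<Phi> u $$ (i, j))
        = (\<lambda>u. indicat_real {0..} u *\<^sub>R mat_exp (u \<cdot>\<^sub>m A) $$ (i, j))"
      using assms(4) by (auto simp: indicator_def)
    moreover have "\<dots> \<in> borel_measurable lborel"
      using borel_measurable_continuous_onI[OF entry(1)] by measurable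
    ultimately show "set_borel_measurable lebesgue {0..} (\<lambda>u. \<Phi> u $$ (i, j))"
      unfolding set_borel_measurable_def by (simp add: measurable_completion)
    obtain C \<epsilon> where "0 < \<epsilon>" "\<And>t. t \<ge> 0 \<Longrightarrow> \<bar>mat_exp (t \<cdot>\<^sub>m A) $$ (i, j)\<bar> \<le> C * exp (- \<epsilon> * t)"
      using entry(2) by blast
    then show "(\<integral>\<^sup>+u\<in>{0..}. ennreal (\<bar>\<Phi> u $$ (i, j)\<bar> powr p) \<partial>lebesgue) < \<infinity>"
      using assms(4) \<open>p > 0\<close> by (intro nn_integral_powr_exp_decay[of p \<epsilon> _ C]) auto
  qed
next
  let ?E = "\<lambda>t. mat_exp (t \<cdot>\<^sub>m A)"
  \<comment> \<open>The entries at time 0 form the identity matrix, so the leading coefficient is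
    \<open>det I = 1\<close>, which is nonzero.\<close>
  have "leading_term (conv_det d ?E) (det (1\<^sub>m d :: real mat)) (d - 1)"
    using assms(1) stable_mat_exp_entry(3)[OF assms(2,3)] by (intro leading_term_conv_det) auto
  then have "0 \<in> ess_supp (conv_det d ?E)"
    by (rule leading_term_ess_supp) simp
  moreover have "conv_det d \<Phi> t = conv_det d ?E t" if "t \<ge> 0" for t
    unfolding conv_det_def using assms(4) that
    by (intro sum.cong refl arg_cong2[where f = "(*)"] conv_upto_cong) auto
  then have "ess_supp (conv_det d \<Phi>) = ess_supp (conv_det d ?E)"
    unfolding ess_supp_def by (simp cong: if_cong)
  ultimately show "0 \<in> ess_supp (conv_det d \<Phi>)" by simp
qed

end
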